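(* Let $n\ge1$, let $\mathfrak{e}_n\subset\mathbb{R}$ be a period-$n$ set, and let $G_n$ be its Green's function. Let $\alpha>0$ and let $\mathfrak{e}_n^\alpha=\{z\in\mathbb{C} : G_n(z)=\alpha\}$. Then for every $k=1,2,\dots$, $$T_{kn}^{(\mathfrak{e}_n^\alpha)}=T_{kn}^{(\mathfrak{e}_n)}$$ and $$t_{kn}^{(\mathfrak{e}_n^\alpha)}=\cosh(kn\alpha)\,t_{kn}^{(\mathfrak{e}_n)}.$$
   Context: A period-$n$ set is a subset $\mathfrak{e}_n\subset\mathbb{R}$ for which there is a polynomial $P_n$ of degree $n$ with $\mathfrak{e}_n=P_n^{-1}([-2,2])=\{z\in\mathbb{C} : P_n(z)\in[-2,2]\}$. The Green's function of a compact set is the Green's function, with pole at infinity, of the unbounded component of its complement (set to $0$ on $\mathfrak{e}_n$). For a compact, not finite, set $\mathfrak{e}\subset\mathbb{C}$, $\|f\|_{\mathfrak{e}}=\sup_{z\in\mathfrak{e}}|f(z)|$; the Chebyshev polynomial $T_m^{(\mathfrak{e})}$ is the unique monic polynomial of degree $m$ minimizing $\|P\|_{\mathfrak{e}}$ over all monic polynomials $P$ of degree $m$, and $t_m^{(\mathfrak{e})}=\|T_m^{(\mathfrak{e})}\|_{\mathfrak{e}}$. *)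

theory Defs
  imports
    "HOL-Analysis.Analysis"
    "HOL-Computational_Algebra.Computational_Algebra"
    "HOL-Library.Landau_Symbols"
begin

definition period_set :: "nat \<Rightarrow> complex set \<Rightarrow> bool" where
  "period_set n e \<longleftrightarrow>
     e \<subseteq> \<real> \<and> (\<exists>P :: complex poly. degree P = n \<and> e = {z. poly P z \<in> complex_of_real ` {-2..2}})"

text \<open>
  Harmonicity on an open set: twice continuously differentiable in the real sense, with vanishing
  Laplacian. The witnesses are the first and second partial derivatives of \<open>u\<close>.
\<close>

definition harmonic_on :: "(complex \<Rightarrow> real) \<Rightarrow> complex set \<Rightarrow> bool" where
  "harmonic_on u S \<longleftrightarrow> open S \<and>
     (\<exists>ux uy uxx uxy uyx uyy.
        continuous_on S uxx \<and> continuous_on S uxy \<and> continuous_on S uyx \<and> continuous_on S uyy \<and>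
        (\<forall>z\<in>S. (u has_derivative (\<lambda>h. ux z * Re h + uy z * Im h)) (at z) \<and>
               (ux has_derivative (\<lambda>h. uxx z * Re h + uxy z * Im h)) (at z) \<and>
               (uy has_derivative (\<lambda>h. uyx z * Re h + uyy z * Im h)) (at z) \<and>
               uxx z + uyy z = 0))"

text \<open>
  Green's function with pole at infinity of the unbounded component \<open>outside e\<close> of the complement
  of a compact set \<open>e\<close>, extended by \<open>0\<close>. The logarithmic pole is expressed as
  \<open>G z = ln (cmod z) + O(1)\<close>. The boundary condition is the classical one, required at every
  boundary point; for \<open>e \<noteq> {}\<close> such a function exists exactly when \<open>outside e\<close> is regular for the Dirichlet
  problem, as it is for period-\<open>n\<close> sets with \<open>n \<ge> 1\<close>.
\<close>

definition is_Green_function :: "complex set \<Rightarrow> (complex \<Rightarrow> real) \<Rightarrow> bool" where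
  "is_Green_function e G \<longleftrightarrow>
     harmonic_on G (outside e) \<and>
     (\<lambda>z. G z - ln (cmod z)) \<in> O[at_infinity](\<lambda>_. 1) \<and>
     (\<forall>w\<in>frontier (outside e). (G \<longlongrightarrow> 0) (at w within outside e)) \<and>
     (\<forall>z. z \<notin> outside e \<longrightarrow> G z = 0)"

definition Green_function :: "complex set \<Rightarrow> complex \<Rightarrow> real" where
  "Green_function e = (THE G. is_Green_function e G)"

definition sup_norm :: "complex set \<Rightarrow> (complex \<Rightarrow> complex) \<Rightarrow> real" where
  "sup_norm e f = (SUP z\<in>e. cmod (f z))"

definition Chebyshev_poly :: "nat \<Rightarrow> complex set \<Rightarrow> complex poly" where
  "Chebyshev_poly m e =
     (THE p. is_arg_min (\<lambda>q. sup_norm e (poly q)) (\<lambda>q. degree q = m \<and> lead_coeff q = 1) p)"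

definition Chebyshev_norm :: "nat \<Rightarrow> complex set \<Rightarrow> real" where
  "Chebyshev_norm m e = sup_norm e (poly (Chebyshev_poly m e))"

end

theory Submission
  imports Defs "HOL-Complex_Analysis.Cauchy_Integral_Formula"
begin

text \<open>
  Let \<open>e\<close> be the preimage of \<open>{-2..2}\<close> under \<open>P\<close>, of degree \<open>n\<close>. Writing \<open>P z = w + 1 / w\<close> with
  \<open>cmod w \<ge> 1\<close>, the Green's function of \<open>e\<close> is \<open>ln (cmod w) / n\<close>, so both \<open>e\<close> and the level set are of
  the form \<open>cmod w = exp s\<close>, with \<open>s = 0\<close> and \<open>s = n * \<alpha>\<close>. On such a set the polynomial \<open>F\<close> with
  \<open>F z = w ^ k + 1 / w ^ k\<close> is bounded by \<open>M = 2 * cosh (k * s)\<close>, and the set contains all solutions of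
  \<open>F z = M\<close> and \<open>F z = - M\<close>. This alone makes \<open>F\<close>, divided by its leading coefficient, the unique
  Chebyshev polynomial: if \<open>q\<close> has the degree and leading coefficient of \<open>F\<close>, the sums of \<open>q - F\<close>
  over the roots of \<open>F - M\<close> and of \<open>F + M\<close> agree, hence \<open>cmod q \<le> M\<close> forces \<open>q = F\<close> at all these
  roots, and there are more than \<open>degree F\<close> of them.
\<close>

section \<open>Extremal polynomials\<close>

text \<open>Synthetic division is Horner's scheme: its quotient coefficients are Horner tails.
  Reading them as polynomials in the division point \<open>c\<close> is what allows summing them
  over roots.\<close>

lemma coeff_synthetic_div: "coeff (synthetic_div p c) i = poly (poly_shift (Suc i) p) c"
proof (induction p arbitrary: i)
  case 0
  show ?case by simp
next
  case (pCons a p)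
  have "poly_shift (Suc j) (pCons a p) = poly_shift j p" for j
    by (simp add: poly_eq_iff coeff_poly_shift)
  then show ?case
    by (cases i) (simp_all add: pCons.IH)
qed

lemma degree_poly_shift: "degree (poly_shift n p) = degree p - n"
proof (rule antisym)
  show "degree (poly_shift n p) \<le> degree p - n"
    by (rule degree_le) (auto simp: coeff_poly_shift coeff_eq_0)
  show "degree p - n \<le> degree (poly_shift n p)"
  proof (cases "degree p > n")
    case True
    then show ?thesis
      by (intro le_degree) (auto simp: coeff_poly_shift)
  qed simp
qed

text \<open>This is the product rule: each linear factor has derivative 1, and omitting one copy of
  a factor amounts to synthetic division at its root. The multiset keeps track of
  multiplicities.\<close>

lemma pderiv_prod_mset_linear:
  fixes A :: "'a :: field multiset"
  defines "p \<equiv> \<lambda>A. \<Prod>a\<in>#A. [:- a, 1:]"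
  shows "pderiv (p A) = (\<Sum>a\<in>#A. synthetic_div (p A) a)"
proof -
  have div: "synthetic_div (p A) a = p (A - {#a#})" if "a \<in># A" for a and A :: "'a multiset"
  proof -
    have "p A = [:- a, 1:] * p (A - {#a#})"
      using that unfolding p_def by (metis image_mset_add_mset insert_DiffM prod_mset.add_mset)
    moreover have "[:- a, 1:] * synthetic_div (p A) a = p A"
    proof -
      have "poly (p A) a = 0"
        unfolding calculation by simp
      then show ?thesis
        using synthetic_div_correct'[of a "p A"] by simp
    qed
    ultimately have "[:- a, 1:] * synthetic_div (p A) a = [:- a, 1:] * p (A - {#a#})"
      by simp
    then show ?thesis
      by (subst (asm) mult_cancel_left) auto
  qed
  have "pderiv (p A) = (\<Sum>a\<in>#A. p (A - {#a#}))"
  proof (induction A)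
    case empty
    show ?case by (simp add: p_def)
  next
    case (add b A)
    have "p (add_mset b A) = [:- b, 1:] * p A"
      by (simp add: p_def)
    then have "pderiv (p (add_mset b A)) = p A + [:- b, 1:] * (\<Sum>a\<in>#A. p (A - {#a#}))"
      by (simp only: pderiv_mult add.IH) (simp add: pderiv_pCons)
    also have "[:- b, 1:] * (\<Sum>a\<in>#A. p (A - {#a#})) = (\<Sum>a\<in>#A. p (add_mset b A - {#a#}))"
      unfolding sum_mset_distrib_left
    proof (rule arg_cong[of _ _ sum_mset], rule image_mset_cong)
      fix a assume "a \<in># A"
      then have "add_mset b A - {#a#} = add_mset b (A - {#a#})"
        by simp
      then show "[:- b, 1:] * p (A - {#a#}) = p (add_mset b A - {#a#})"
        by (simp add: p_def)
    qed
    finally show ?case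
      by simp
  qed
  also have "\<dots> = (\<Sum>a\<in>#A. synthetic_div (p A) a)"
    using div by (intro arg_cong[of _ _ sum_mset] image_mset_cong) simp
  finally show ?thesis .
qed

lemma synthetic_div_smult: "synthetic_div (smult a p) c = smult a (synthetic_div p c)"
  by (induction p) simp_all

lemma degree_diff_const: "degree (p - [:b:]) = degree p"
proof (cases p)
  case (pCons a q)
  then show ?thesis by (cases "q = 0") auto
qed

lemma synthetic_div_diff_const: "synthetic_div (p - [:b:]) c = synthetic_div p c"
proof (cases p)
  case (pCons a q)
  then show ?thesis by simp
qed

text \<open>Over the complex numbers every polynomial is a constant times such a product, and both
  sides scale by the leading coefficient.\<close>

lemma pderiv_conv_proots:
  fixes p :: "complex poly"
  shows "pderiv p = (\<Sum>a\<in>#proots p. synthetic_div p a)"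
proof -
  define q where "q = (\<Prod>a\<in>#proots p. [:- a, 1:])"
  have p: "p = smult (lead_coeff p) q"
    by (simp only: q_def complex_poly_decompose_multiset)
  have "pderiv q = (\<Sum>a\<in>#proots p. synthetic_div q a)"
    unfolding q_def by (rule pderiv_prod_mset_linear)
  then have "pderiv p = smult (lead_coeff p) (\<Sum>a\<in>#proots p. synthetic_div q a)"
    by (subst p) (simp add: pderiv_smult)
  also have "\<dots> = (\<Sum>a\<in>#proots p. smult (lead_coeff p) (synthetic_div q a))"
  proof -
    have "smult c (\<Sum>a\<in>#A. g a) = (\<Sum>a\<in>#A. smult c (g a))"
      for c and g :: "complex \<Rightarrow> complex poly" and A
      by (induction A) (simp_all add: smult_add_right)
    then show ?thesis .
  qed
  also have "\<dots> = (\<Sum>a\<in>#proots p. synthetic_div p a)"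
  proof -
    have "synthetic_div p a = smult (lead_coeff p) (synthetic_div q a)" for a
      by (subst p) (simp only: synthetic_div_smult)
    then show ?thesis by simp
  qed
  finally show ?thesis .
qed

text \<open>
  This is Newton's theorem that the power sums of order less than \<open>degree f\<close> of the roots
  of \<open>f - c\<close> do not depend on \<open>c\<close>: the derivative of \<open>f - c\<close> is a sum over its roots \<open>a\<close> of
  \<open>(f - f a) / (x - a)\<close>, whose coefficients, as polynomials in \<open>a\<close>, span the polynomials of smaller
  degree.
\<close>

lemma sum_proots_diff_const:
  fixes f h :: "complex poly"
  assumes "degree h < degree f"
  shows "(\<Sum>a\<in>#proots (f - [:b:]). poly h a) = (\<Sum>a\<in>#proots (f - [:c:]). poly h a)"
proof -
  define L where "L h b = (\<Sum>a\<in>#proots (f - [:b:]). poly h a)" for h b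
  \<comment> \<open>The right-hand side does not mention \<open>b\<close>: subtracting a constant
    changes neither the derivative nor the quotients. So \<open>L\<close> is independent of
    \<open>b\<close> on all these shifts.\<close>
  have shift: "L (poly_shift (Suc i) f) b = coeff (pderiv f) i" for i b
  proof -
    have "pderiv f = pderiv (f - [:b:])"
      by (simp add: pderiv_diff pderiv_pCons)
    also have "\<dots> = (\<Sum>a\<in>#proots (f - [:b:]). synthetic_div f a)"
      by (subst pderiv_conv_proots) (simp add: synthetic_div_diff_const[abs_def])
    also have "coeff \<dots> i = (\<Sum>a\<in>#proots (f - [:b:]). coeff (synthetic_div f a) i)"
    proof -
      have "coeff (\<Sum>a\<in>#A. g a) i = (\<Sum>a\<in>#A. coeff (g a) i)"
        for g :: "complex \<Rightarrow> complex poly" and A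
        by (induction A) simp_all
      then show ?thesis .
    qed
    finally show ?thesis
      by (simp add: L_def coeff_synthetic_div)
  qed
  have L_0: "L 0 b = 0" for b
    by (simp add: L_def)
  have L_add: "L (smult c g + h) b = c * L g b + L h b" for c g h b
    by (simp add: L_def sum_mset.distrib sum_mset_distrib_left)
  have "L h b = L h c"
    using assms
  proof (induction "degree h" arbitrary: h rule: less_induct)
    case less
    \<comment> \<open>This shift of \<open>f\<close> has the degree of \<open>h\<close> and the
      leading coefficient of \<open>f\<close>, so a multiple of it cancels the leading term of
      \<open>h\<close>. As \<open>degree h < degree f\<close>, the shift is by at least one, as
      \<open>shift\<close> requires.\<close>
    define g where "g = poly_shift (degree f - degree h) f"
    define d where "d = lead_coeff h / lead_coeff f"
    define r where "r = h - smult d g"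
    have f0: "lead_coeff f \<noteq> 0"
      using less.prems by auto
    have h: "h = smult d g + r"
      by (simp add: r_def)
    obtain i where i: "degree f - degree h = Suc i"
      using less.prems by (metis Suc_diff_Suc)
    have "L g b = L g c"
      unfolding g_def i by (simp only: shift)
    moreover have "L r b = L r c"
    proof (cases "r = 0")
      case False
      have "degree g = degree h"
        using less.prems by (simp add: g_def degree_poly_shift)
      then have "degree r \<le> degree h"
        unfolding r_def by (intro degree_diff_le) simp_all
      moreover have "coeff r (degree h) = 0"
        using less.prems f0 by (simp add: r_def g_def d_def coeff_poly_shift)
      ultimately have "degree r < degree h"
        using False by (metis le_neq_implies_less leading_coeff_0_iff)
      then show ?thesis
        using less by simp
    qed (simp add: L_0)
    ultimately show ?case
      by (subst (1 2) h) (simp only: L_add)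
  qed
  then show ?thesis
    by (simp add: L_def)
qed

lemma sum_order_proots_complex:
  fixes p :: "complex poly"
  assumes "p \<noteq> 0"
  shows "(\<Sum>a | poly p a = 0. order a p) = degree p"
  using size_proots_complex[of p] assms by (simp add: size_multiset_overloaded_eq)

text \<open>
  A root of \<open>f - b\<close> of multiplicity \<open>m\<close> is a root of \<open>pderiv f\<close> of multiplicity \<open>m - 1\<close>, so
  only \<open>degree f - 1\<close> of the \<open>2 * degree f\<close> roots can be lost to multiplicities.
\<close>

lemma card_two_level_sets:
  fixes f :: "complex poly"
  assumes f: "degree f > 0" and "b \<noteq> c"
  shows "degree f < card {z. poly f z = b \<or> poly f z = c}"
proof -
  define R where "R b = {z. poly (f - [:b:]) z = 0}" for b
  have nz: "f - [:b:] \<noteq> 0" for b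
    using f by auto
  have f': "pderiv f \<noteq> 0"
    using f by (simp add: pderiv_eq_0_iff)
  have fin: "finite (R b)" for b
    unfolding R_def using nz by (rule poly_roots_finite)
  have count: "degree f = card (R b) + (\<Sum>a\<in>R b. order a (pderiv f))" for b
  proof -
    have "pderiv (f - [:b:]) = pderiv f"
      by (simp add: pderiv_diff pderiv_pCons)
    then have "order a (f - [:b:]) = Suc (order a (pderiv f))" if "a \<in> R b" for a
      using order_pderiv[OF nz, of b a] that by (simp add: R_def)
    then have "(\<Sum>a\<in>R b. order a (f - [:b:])) = (\<Sum>a\<in>R b. Suc (order a (pderiv f)))"
      by (rule sum.cong[OF refl])
    then show ?thesis
      using sum_order_proots_complex[OF nz, of b] by (simp add: R_def degree_diff_const sum_Suc)
  qed
  have disj: "R b \<inter> R c = {}"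
    using \<open>b \<noteq> c\<close> by (auto simp: R_def)
  have "(\<Sum>a\<in>R b. order a (pderiv f)) + (\<Sum>a\<in>R c. order a (pderiv f))
      = (\<Sum>a\<in>R b \<union> R c. order a (pderiv f))"
    using fin disj by (simp add: sum.union_disjoint)
  also have "\<dots> = (\<Sum>a\<in>(R b \<union> R c) \<inter> {a. poly (pderiv f) a = 0}. order a (pderiv f))"
    using fin by (intro sum.mono_neutral_right) (auto simp: order_root)
  also have "\<dots> \<le> (\<Sum>a | poly (pderiv f) a = 0. order a (pderiv f))"
    using poly_roots_finite[OF f'] by (intro sum_mono2) auto
  also have "\<dots> \<le> degree (pderiv f)"
    by (rule sum_order_le_degree[OF f'])
  also have "\<dots> = degree f - 1"
    by (rule degree_pderiv)
  finally have "card (R b) + card (R c) > degree f"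
    using count[of b] count[of c] f by linarith
  then have "card (R b \<union> R c) > degree f"
    using fin disj by (simp add: card_Un_disjoint)
  moreover have "R b \<union> R c = {z. poly f z = b \<or> poly f z = c}"
    by (auto simp: R_def)
  ultimately show ?thesis
    by simp
qed

section \<open>From root sums to extremality\<close>

lemma sum_mset_Re_le:
  fixes g :: "'a \<Rightarrow> complex" and M :: real
  assumes "\<And>a. a \<in># A \<Longrightarrow> cmod (g a) \<le> M"
  shows "Re (\<Sum>a\<in>#A. g a) \<le> size A * M"
    and "Re (\<Sum>a\<in>#A. g a) = size A * M \<Longrightarrow> a \<in># A \<Longrightarrow> g a = of_real M"
proof -
  have le: "Re (g a) \<le> M" if "a \<in># A" for a
    using complex_Re_le_cmod[of "g a"] assms[OF that] by linarith
  then have main: "Re (\<Sum>a\<in>#A. g a) \<le> size A * M \<and>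
      (Re (\<Sum>a\<in>#A. g a) = size A * M \<longrightarrow> (\<forall>a\<in>#A. Re (g a) = M))"
  proof (induction A)
    case (add b A)
    from add.IH add.prems
    have IH: "Re (\<Sum>a\<in>#A. g a) \<le> size A * M"
        "Re (\<Sum>a\<in>#A. g a) = size A * M \<Longrightarrow> \<forall>a\<in>#A. Re (g a) = M"
      by simp_all
    moreover have "Re (g b) \<le> M"
      using add.prems by simp
    ultimately show ?case
      by (auto simp: algebra_simps)
  qed simp
  then show "Re (\<Sum>a\<in>#A. g a) \<le> size A * M"
    by blast
  assume "Re (\<Sum>a\<in>#A. g a) = size A * M" "a \<in># A"
  \<comment> \<open>A total of \<open>size A * M\<close> leaves no slack in any summand. A real part
    equal to the bound \<open>M\<close> on the modulus then leaves no room for an imaginary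
    part.\<close>
  with main have re: "Re (g a) = M"
    by blast
  have "(cmod (g a))\<^sup>2 \<le> M\<^sup>2"
    using assms[OF \<open>a \<in># A\<close>] by (intro power_mono) auto
  with re have "(Im (g a))\<^sup>2 \<le> 0"
    by (simp add: cmod_power2)
  with re show "g a = of_real M"
    by (simp add: complex_eq_iff)
qed

lemma equioscillation_unique:
  fixes F q :: "complex poly"
  assumes F: "degree F > 0" "degree q = degree F" "lead_coeff q = lead_coeff F" and M: "M > 0"
    and E: "\<And>z. poly F z = of_real M \<or> poly F z = - of_real M \<Longrightarrow> z \<in> E"
    and q: "\<And>z. z \<in> E \<Longrightarrow> cmod (poly q z) \<le> M"
  shows "q = F"
proof -
  define A B where "A = proots (F - [:of_real M:])" and "B = proots (F - [:of_real (- M):])"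
  have nz: "F - [:b:] \<noteq> 0" for b
    using F by auto
  have mem: "a \<in># A \<longleftrightarrow> poly F a = of_real M" "a \<in># B \<longleftrightarrow> poly F a = - of_real M" for a
    using nz by (simp_all add: A_def B_def algebra_simps eq_neg_iff_add_eq_0)
  have size: "size A = degree F" "size B = degree F"
    by (simp_all only: A_def B_def size_proots_complex degree_diff_const)
  have "(\<Sum>a\<in>#A. poly q a) - (\<Sum>a\<in>#B. poly q a) = of_real (2 * degree F * M)"
  proof -
    \<comment> \<open>Equality of the leading coefficients brings \<open>q - F\<close> within reach
      of \<open>sum_proots_diff_const\<close>; its two root sums cancel, so the difference of the
      sums for \<open>q\<close> is the one for \<open>F\<close>.\<close>
    have "degree (q - F) < degree F"
    proof (rule degree_lessI)
      show "\<forall>k\<ge>degree F. coeff (q - F) k = 0"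
        using F by (metis coeff_0 coeff_diff coeff_eq_0 diff_self le_neq_implies_less)
    qed (use F in auto)
    then have "(\<Sum>a\<in>#A. poly (q - F) a) = (\<Sum>a\<in>#B. poly (q - F) a)"
      unfolding A_def B_def by (rule sum_proots_diff_const)
    moreover have "image_mset (poly F) A = image_mset (\<lambda>_. of_real M) A"
      "image_mset (poly F) B = image_mset (\<lambda>_. - of_real M) B"
      by (auto simp: mem intro!: image_mset_cong)
    moreover have "(\<Sum>a\<in>#C. poly q a) = (\<Sum>a\<in>#C. poly (q - F) a) + (\<Sum>a\<in>#C. poly F a)" for C
      by (simp flip: sum_mset.distrib)
    ultimately show ?thesis
      by (simp add: size)
  qed
  moreover have "(\<Sum>a\<in>#B. - poly q a) = - (\<Sum>a\<in>#B. poly q a)"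
    by (induction B) simp_all
  ultimately have eq: "Re (\<Sum>a\<in>#A. poly q a) + Re (\<Sum>a\<in>#B. - poly q a) = 2 * degree F * M"
    by (simp add: complex_eq_iff)
  have bA: "cmod (poly q a) \<le> M" if "a \<in># A" for a
    using that by (simp add: mem E q)
  have bB: "cmod (- poly q a) \<le> M" if "a \<in># B" for a
    using that by (simp add: mem E q)
  \<comment> \<open>Each of the two real parts is at most \<open>degree F * M\<close> while their
    total is twice that, so equality holds in both, and then in every term.\<close>
  note leA = sum_mset_Re_le[of A "poly q", OF bA, unfolded size]
  note leB = sum_mset_Re_le[of B "\<lambda>a. - poly q a", OF bB, unfolded size]
  have eqA: "Re (\<Sum>a\<in>#A. poly q a) = degree F * M"
    and eqB: "Re (\<Sum>a\<in>#B. - poly q a) = degree F * M"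
    using eq leA(1) leB(1) by simp_all
  have "poly q a = poly F a" if "poly F a = of_real M \<or> poly F a = - of_real M" for a
    using that leA(2)[OF _ eqA] leB(2)[OF _ eqB] mem[of a] by (metis minus_minus)
  then show ?thesis
    using card_two_level_sets[of F "of_real M" "- of_real M"] F M
    by (intro poly_eqI_degree[of "{a. poly F a = of_real M \<or> poly F a = - of_real M}"]) auto
qed

text \<open>Any competitor of norm at most \<open>M / cmod c\<close>, scaled by \<open>c\<close>,
  equals \<open>F\<close> by \<open>equioscillation_unique\<close>. This gives minimality and
  uniqueness at once, so the description by \<open>THE\<close> is justified.\<close>

lemma Chebyshev_poly_eqI:
  fixes F :: "complex poly"
  assumes F: "degree F > 0" and "bounded E" and M: "M > 0"
    and E: "\<And>z. poly F z = of_real M \<or> poly F z = - of_real M \<Longrightarrow> z \<in> E"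
    and le: "\<And>z. z \<in> E \<Longrightarrow> cmod (poly F z) \<le> M"
  shows "Chebyshev_poly (degree F) E = smult (inverse (lead_coeff F)) F"
    and "Chebyshev_norm (degree F) E = M / cmod (lead_coeff F)"
proof -
  define c where "c = lead_coeff F"
  define T where "T = smult (inverse c) F"
  have c: "c \<noteq> 0"
    using F by (auto simp: c_def)
  have T: "degree T = degree F" "lead_coeff T = 1"
    using c by (simp_all add: T_def c_def[symmetric])
  \<comment> \<open>Such a point lies in \<open>E\<close>, so the supremum is over a nonempty set
    and the bound \<open>M\<close> is attained.\<close>
  obtain z0 where z0: "poly F z0 = of_real M"
  proof -
    have "\<not> constant (poly (F - [:of_real M:]))"
      using F by (simp add: constant_degree degree_diff_const)
    from Fundamental_Theorem_Algebra.fundamental_theorem_of_algebra[OF this] that show ?thesis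
      by auto
  qed
  \<comment> \<open>The supremum is taken in the reals, where it dominates its members only if the
    set of values is bounded above.\<close>
  have bdd: "bdd_above ((\<lambda>z. cmod (poly q z)) ` E)" for q
  proof -
    have "compact (closure E)"
      using \<open>bounded E\<close> by (simp add: compact_closure)
    then have "bounded ((\<lambda>z. cmod (poly q z)) ` closure E)"
      by (intro compact_imp_bounded compact_continuous_image continuous_intros)
    then show ?thesis
      using closure_subset[of E] by (meson bounded_imp_bdd_above bounded_subset image_mono)
  qed
  have norm_T: "sup_norm E (poly T) = M / cmod c"
    unfolding sup_norm_def
  proof (rule cSup_eq_maximum)
    show "M / cmod c \<in> (\<lambda>z. cmod (poly T z)) ` E"
      using z0 E[of z0] M by (intro image_eqI[of _ _ z0]) (simp_all add: T_def norm_mult norm_inverse divide_inverse)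
    show "x \<le> M / cmod c" if "x \<in> (\<lambda>z. cmod (poly T z)) ` E" for x
      using that le by (auto simp: T_def norm_mult norm_inverse divide_inverse mult.commute[of M]
          intro!: mult_left_mono)
  qed
  have unique: "q = T"
    if q: "degree q = degree F \<and> lead_coeff q = 1" and "sup_norm E (poly q) \<le> M / cmod c" for q
  proof -
    have "smult c q = F"
    proof (rule equioscillation_unique[OF F _ _ M E])
      show "degree (smult c q) = degree F" "lead_coeff (smult c q) = lead_coeff F"
        using q c by (auto simp: c_def)
      show "cmod (poly (smult c q) z) \<le> M" if "z \<in> E" for z
      proof -
        have "cmod (poly q z) \<le> sup_norm E (poly q)"
          unfolding sup_norm_def by (rule cSUP_upper[OF that bdd])
        also note \<open>sup_norm E (poly q) \<le> M / cmod c\<close>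
        finally show ?thesis
          using c by (simp add: norm_mult field_simps)
      qed
    qed
    then show ?thesis
      using c by (auto simp: T_def)
  qed
  have "Chebyshev_poly (degree F) E = T"
    unfolding Chebyshev_poly_def
  proof (rule the_equality)
    show "is_arg_min (\<lambda>q. sup_norm E (poly q)) (\<lambda>q. degree q = degree F \<and> lead_coeff q = 1) T"
      unfolding is_arg_min_def using T unique norm_T by (metis less_imp_le less_irrefl)
    show "p = T"
      if "is_arg_min (\<lambda>q. sup_norm E (poly q)) (\<lambda>q. degree q = degree F \<and> lead_coeff q = 1) p" for p
      using that T unfolding is_arg_min_def by (intro unique) (auto simp: not_less simp flip: norm_T)
  qed
  then show "Chebyshev_poly (degree F) E = smult (inverse (lead_coeff F)) F"
      "Chebyshev_norm (degree F) E = M / cmod (lead_coeff F)"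
    using norm_T by (simp_all add: Chebyshev_norm_def T_def c_def)
qed

section \<open>Harmonic functions and uniqueness of Green functions\<close>

lemma harmonic_onI:
  assumes "open S"
    and "continuous_on S uxx" "continuous_on S uxy" "continuous_on S uyx" "continuous_on S uyy"
    and "\<And>z. z \<in> S \<Longrightarrow> (u has_derivative (\<lambda>h. ux z * Re h + uy z * Im h)) (at z)"
    and "\<And>z. z \<in> S \<Longrightarrow> (ux has_derivative (\<lambda>h. uxx z * Re h + uxy z * Im h)) (at z)"
    and "\<And>z. z \<in> S \<Longrightarrow> (uy has_derivative (\<lambda>h. uyx z * Re h + uyy z * Im h)) (at z)"
    and "\<And>z. z \<in> S \<Longrightarrow> uxx z + uyy z = 0"
  shows "harmonic_on u S"
  unfolding harmonic_on_def
  by (rule conjI, fact, rule exI[of _ ux], rule exI[of _ uy], rule exI[of _ uxx],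
      rule exI[of _ uxy], rule exI[of _ uyx], rule exI[of _ uyy]) (simp add: assms)

lemma harmonic_onE:
  assumes "harmonic_on u S"
  obtains ux uy uxx uxy uyx uyy where "open S"
    "\<forall>z\<in>S. (u has_derivative (\<lambda>h. ux z * Re h + uy z * Im h)) (at z)"
    "\<forall>z\<in>S. (ux has_derivative (\<lambda>h. uxx z * Re h + uxy z * Im h)) (at z)"
    "\<forall>z\<in>S. (uy has_derivative (\<lambda>h. uyx z * Re h + uyy z * Im h)) (at z)"
    "\<forall>z\<in>S. uxx z + uyy z = 0"
    "continuous_on S uxx" "continuous_on S uxy" "continuous_on S uyx" "continuous_on S uyy"
  using assms unfolding harmonic_on_def
proof (elim conjE exE)
  fix ux uy uxx uxy uyx uyy
  assume "open S"
    "continuous_on S uxx" "continuous_on S uxy" "continuous_on S uyx" "continuous_on S uyy"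
    "\<forall>z\<in>S. (u has_derivative (\<lambda>h. ux z * Re h + uy z * Im h)) (at z) \<and>
       (ux has_derivative (\<lambda>h. uxx z * Re h + uxy z * Im h)) (at z) \<and>
       (uy has_derivative (\<lambda>h. uyx z * Re h + uyy z * Im h)) (at z) \<and>
       uxx z + uyy z = 0"
  then show thesis
    by (intro that[of ux uy uxx uxy uyx uyy]) simp_all
qed

text \<open>The assumption says that \<open>f\<close> is \<open>ux - \<i> * uy\<close>, so the
  Cauchy-Riemann equations for \<open>f\<close> give the vanishing Laplacian. Working with
  \<open>f\<close> alone avoids a harmonic conjugate of \<open>u\<close>, which may be multivalued
  on \<open>S\<close>.\<close>

lemma harmonic_on_real_derivative:
  assumes "open S" and f: "f holomorphic_on S"
    and u: "\<And>z. z \<in> S \<Longrightarrow> (u has_derivative (\<lambda>h. Re (f z * h))) (at z)"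
  shows "harmonic_on u S"
proof -
  have f': "continuous_on S (deriv f)"
    using assms by (intro holomorphic_on_imp_continuous_on holomorphic_deriv)
  have df: "(f has_derivative (\<lambda>h. deriv f z * h)) (at z)" if "z \<in> S" for z
    using holomorphic_derivI[OF f \<open>open S\<close> that] by (simp add: has_field_derivative_def)
  show ?thesis
  proof (rule harmonic_onI[where ux = "\<lambda>z. Re (f z)" and uy = "\<lambda>z. - Im (f z)"
        and uxx = "\<lambda>z. Re (deriv f z)" and uxy = "\<lambda>z. - Im (deriv f z)"
        and uyx = "\<lambda>z. - Im (deriv f z)" and uyy = "\<lambda>z. - Re (deriv f z)"])
    fix z assume z: "z \<in> S"
    show "(u has_derivative (\<lambda>h. Re (f z) * Re h + (- Im (f z)) * Im h)) (at z)"
      using u[OF z] by simp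
    show "((\<lambda>z. Re (f z)) has_derivative
        (\<lambda>h. Re (deriv f z) * Re h + (- Im (deriv f z)) * Im h)) (at z)"
      using has_derivative_Re[OF df[OF z]] by simp
    show "((\<lambda>z. - Im (f z)) has_derivative
        (\<lambda>h. (- Im (deriv f z)) * Re h + (- Re (deriv f z)) * Im h)) (at z)"
      using has_derivative_minus[OF has_derivative_Im[OF df[OF z]]] by (simp add: algebra_simps)
    show "Re (deriv f z) + - Re (deriv f z) = 0"
      by simp
  qed (intro continuous_intros f' \<open>open S\<close>)+
qed

lemma harmonic_on_linear_combination:
  assumes "harmonic_on u S" "harmonic_on v S"
  shows "harmonic_on (\<lambda>z. a * u z + b * v z) S"
proof -
  from assms(1) obtain ux uy uxx uxy uyx uyy where u:
    "open S"
    "\<forall>z\<in>S. (u has_derivative (\<lambda>h. ux z * Re h + uy z * Im h)) (at z)"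
    "\<forall>z\<in>S. (ux has_derivative (\<lambda>h. uxx z * Re h + uxy z * Im h)) (at z)"
    "\<forall>z\<in>S. (uy has_derivative (\<lambda>h. uyx z * Re h + uyy z * Im h)) (at z)"
    "\<forall>z\<in>S. uxx z + uyy z = 0"
    "continuous_on S uxx" "continuous_on S uxy" "continuous_on S uyx" "continuous_on S uyy"
    by (rule harmonic_onE)
  from assms(2) obtain vx vy vxx vxy vyx vyy where v:
    "open S"
    "\<forall>z\<in>S. (v has_derivative (\<lambda>h. vx z * Re h + vy z * Im h)) (at z)"
    "\<forall>z\<in>S. (vx has_derivative (\<lambda>h. vxx z * Re h + vxy z * Im h)) (at z)"
    "\<forall>z\<in>S. (vy has_derivative (\<lambda>h. vyx z * Re h + vyy z * Im h)) (at z)"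
    "\<forall>z\<in>S. vxx z + vyy z = 0"
    "continuous_on S vxx" "continuous_on S vxy" "continuous_on S vyx" "continuous_on S vyy"
    by (rule harmonic_onE)
  have lin: "((\<lambda>z. a * f z + b * g z) has_derivative
      (\<lambda>h. (a * p + b * p') * Re h + (a * q + b * q') * Im h)) (at z)"
    if "(f has_derivative (\<lambda>h. p * Re h + q * Im h)) (at z)"
      "(g has_derivative (\<lambda>h. p' * Re h + q' * Im h)) (at z)" for f g p q p' q' z
    using has_derivative_add[OF has_derivative_mult_right[OF that(1), of a]
        has_derivative_mult_right[OF that(2), of b]]
    by (simp add: algebra_simps)
  show ?thesis
  proof (rule harmonic_onI[OF u(1)])
    fix z assume z: "z \<in> S"
    show "((\<lambda>z. a * u z + b * v z) has_derivative
        (\<lambda>h. (a * ux z + b * vx z) * Re h + (a * uy z + b * vy z) * Im h)) (at z)"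
      by (rule lin[OF u(2)[rule_format, OF z] v(2)[rule_format, OF z]])
    show "((\<lambda>z. a * ux z + b * vx z) has_derivative
        (\<lambda>h. (a * uxx z + b * vxx z) * Re h + (a * uxy z + b * vxy z) * Im h)) (at z)"
      by (rule lin[OF u(3)[rule_format, OF z] v(3)[rule_format, OF z]])
    show "((\<lambda>z. a * uy z + b * vy z) has_derivative
        (\<lambda>h. (a * uyx z + b * vyx z) * Re h + (a * uyy z + b * vyy z) * Im h)) (at z)"
      by (rule lin[OF u(4)[rule_format, OF z] v(4)[rule_format, OF z]])
    have "(a * uxx z + b * vxx z) + (a * uyy z + b * vyy z)
        = a * (uxx z + uyy z) + b * (vxx z + vyy z)"
      by (simp add: algebra_simps)
    then show "(a * uxx z + b * vxx z) + (a * uyy z + b * vyy z) = 0"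
      using u(5)[rule_format, OF z] v(5)[rule_format, OF z] by simp
  qed (intro continuous_intros u(6-9) v(6-9))+
qed

lemma harmonic_on_imp_continuous_on:
  assumes "harmonic_on u S"
  shows "continuous_on S u"
proof -
  from assms obtain ux uy uxx uxy uyx uyy where
    "open S"
    "\<forall>z\<in>S. (u has_derivative (\<lambda>h. ux z * Re h + uy z * Im h)) (at z)"
    "\<forall>z\<in>S. (ux has_derivative (\<lambda>h. uxx z * Re h + uxy z * Im h)) (at z)"
    "\<forall>z\<in>S. (uy has_derivative (\<lambda>h. uyx z * Re h + uyy z * Im h)) (at z)"
    "\<forall>z\<in>S. uxx z + uyy z = 0"
    "continuous_on S uxx" "continuous_on S uxy" "continuous_on S uyx" "continuous_on S uyy"
    by (rule harmonic_onE)
  then show ?thesis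
    by (meson continuous_at_imp_continuous_on has_derivative_continuous)
qed

section \<open>Maximum principle and uniqueness\<close>

lemma second_derivative_nonpos_at_local_max:
  fixes g g' :: "real \<Rightarrow> real"
  assumes "d > 0" and g: "\<And>t. \<bar>t\<bar> < d \<Longrightarrow> (g has_real_derivative g' t) (at t)"
    and g'': "(g' has_real_derivative c) (at 0)"
    and max: "\<And>t. \<bar>t\<bar> < d \<Longrightarrow> g t \<le> g 0"
  shows "c \<le> 0"
proof (rule ccontr)
  assume "\<not> c \<le> 0"
  \<comment> \<open>From the value 0, a positive \<open>c\<close> would make \<open>g'\<close>
    positive just to the right of 0, and \<open>g\<close> would rise above its maximum.\<close>
  have "g' 0 = 0"
    using g[of 0] \<open>d > 0\<close> max by (intro DERIV_local_max[of g _ 0 d]) auto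
  with DERIV_pos_inc_right[OF g''] \<open>\<not> c \<le> 0\<close> obtain e
    where e: "e > 0" "\<And>h. 0 < h \<Longrightarrow> h < e \<Longrightarrow> 0 < g' h"
    by auto
  define r where "r = min d e / 2"
  have r: "0 < r" "r < d" "r < e"
    using \<open>d > 0\<close> e(1) by (auto simp: r_def)
  have "g 0 < g r"
  proof (rule DERIV_pos_imp_increasing_open[OF r(1)])
    show "\<exists>y. (g has_real_derivative y) (at x) \<and> 0 < y" if "0 < x" "x < r" for x
      using g[of x] e(2)[of x] that r by auto
    show "continuous_on {0..r} g"
      using r by (intro continuous_at_imp_continuous_on ballI DERIV_isCont[OF g]) auto
  qed
  with max[of r] r show False
    by simp
qed

text \<open>Along the horizontal and the vertical line through \<open>z\<close> the second
  derivatives are \<open>uxx z + 2 * \<delta>\<close> and \<open>uyy z + 2 * \<delta>\<close>. A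
  local maximum would make both nonpositive, but they add up to \<open>4 * \<delta>\<close>.\<close>

lemma harmonic_add_square_no_local_max:
  assumes "harmonic_on u S" "z \<in> S" "\<delta> > 0"
    and max: "eventually (\<lambda>w. u w + \<delta> * (cmod w)\<^sup>2 \<le> u z + \<delta> * (cmod z)\<^sup>2) (nhds z)"
  shows False
proof -
  from assms(1) obtain ux uy uxx uxy uyx uyy where u: "open S"
    "\<forall>z\<in>S. (u has_derivative (\<lambda>h. ux z * Re h + uy z * Im h)) (at z)"
    "\<forall>z\<in>S. (ux has_derivative (\<lambda>h. uxx z * Re h + uxy z * Im h)) (at z)"
    "\<forall>z\<in>S. (uy has_derivative (\<lambda>h. uyx z * Re h + uyy z * Im h)) (at z)"
    "\<forall>z\<in>S. uxx z + uyy z = 0"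
    "continuous_on S uxx" "continuous_on S uxy" "continuous_on S uyx" "continuous_on S uyy"
    by (rule harmonic_onE)
  have "eventually (\<lambda>w. w \<in> S \<and> u w + \<delta> * (cmod w)\<^sup>2 \<le> u z + \<delta> * (cmod z)\<^sup>2) (nhds z)"
    using max u(1) \<open>z \<in> S\<close> by (intro eventually_conj eventually_nhds_in_open)
  then obtain d where "d > 0" and d: "\<And>w. dist w z < d \<Longrightarrow>
      w \<in> S \<and> u w + \<delta> * (cmod w)\<^sup>2 \<le> u z + \<delta> * (cmod z)\<^sup>2"
    unfolding eventually_nhds_metric by blast
  have line: "((\<lambda>t. f (z + of_real t * v)) has_real_derivative (p * Re v + q * Im v)) (at t)"
    if "(f has_derivative (\<lambda>h. p * Re h + q * Im h)) (at (z + of_real t * v))" for f p q t v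
  proof -
    have "((\<lambda>t. z + of_real t * v) has_derivative (\<lambda>s. of_real s * v)) (at t)"
      by (auto intro!: derivative_eq_intros)
    from has_derivative_compose[OF this that] show ?thesis
      unfolding has_field_derivative_def
      by (rule has_derivative_eq_rhs) (simp add: fun_eq_iff algebra_simps)
  qed
  have sq: "((\<lambda>t. \<delta> * ((a + t)\<^sup>2 + b)) has_real_derivative \<delta> * (2 * (a + t))) (at t)"
    and lin: "((\<lambda>t. \<delta> * (2 * (a + t))) has_real_derivative 2 * \<delta>) (at t)" for a b t
    by (auto intro!: derivative_eq_intros)
  have "uxx z + 2 * \<delta> \<le> 0"
  proof (rule second_derivative_nonpos_at_local_max[OF \<open>d > 0\<close>])
    show "((\<lambda>t. u (z + of_real t * 1) + \<delta> * ((Re z + t)\<^sup>2 + (Im z)\<^sup>2)) has_real_derivative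
        ux (z + of_real t * 1) + \<delta> * (2 * (Re z + t))) (at t)" if "\<bar>t\<bar> < d" for t
    proof (rule DERIV_add[OF _ sq])
      have "z + of_real t * 1 \<in> S"
        using d[of "z + of_real t * 1"] that by (simp add: dist_norm)
      from line[OF u(2)[rule_format, OF this]]
      show "((\<lambda>t. u (z + of_real t * 1)) has_real_derivative ux (z + of_real t * 1)) (at t)"
        by simp
    qed
    show "((\<lambda>t. ux (z + of_real t * 1) + \<delta> * (2 * (Re z + t))) has_real_derivative
        uxx z + 2 * \<delta>) (at 0)"
      using line[of ux _ _ 0 1] u(3)[rule_format, OF \<open>z \<in> S\<close>] by (intro DERIV_add[OF _ lin]) simp
    show "u (z + of_real t * 1) + \<delta> * ((Re z + t)\<^sup>2 + (Im z)\<^sup>2)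
        \<le> u (z + of_real 0 * 1) + \<delta> * ((Re z + 0)\<^sup>2 + (Im z)\<^sup>2)" if "\<bar>t\<bar> < d" for t
      using d[of "z + of_real t * 1"] that by (simp add: dist_norm cmod_power2)
  qed
  moreover have "uyy z + 2 * \<delta> \<le> 0"
  proof (rule second_derivative_nonpos_at_local_max[OF \<open>d > 0\<close>])
    show "((\<lambda>t. u (z + of_real t * \<i>) + \<delta> * ((Im z + t)\<^sup>2 + (Re z)\<^sup>2)) has_real_derivative
        uy (z + of_real t * \<i>) + \<delta> * (2 * (Im z + t))) (at t)" if "\<bar>t\<bar> < d" for t
    proof (rule DERIV_add[OF _ sq])
      have "z + of_real t * \<i> \<in> S"
        using d[of "z + of_real t * \<i>"] that by (simp add: dist_norm norm_mult)
      from line[OF u(2)[rule_format, OF this]]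
      show "((\<lambda>t. u (z + of_real t * \<i>)) has_real_derivative uy (z + of_real t * \<i>)) (at t)"
        by simp
    qed
    show "((\<lambda>t. uy (z + of_real t * \<i>) + \<delta> * (2 * (Im z + t))) has_real_derivative
        uyy z + 2 * \<delta>) (at 0)"
      using line[of uy _ _ 0 \<i>] u(4)[rule_format, OF \<open>z \<in> S\<close>] by (intro DERIV_add[OF _ lin]) simp
    show "u (z + of_real t * \<i>) + \<delta> * ((Im z + t)\<^sup>2 + (Re z)\<^sup>2)
        \<le> u (z + of_real 0 * \<i>) + \<delta> * ((Im z + 0)\<^sup>2 + (Re z)\<^sup>2)" if "\<bar>t\<bar> < d" for t
      using d[of "z + of_real t * \<i>"] that by (simp add: dist_norm cmod_power2 norm_mult add.commute)
  qed
  ultimately show False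
    using u(5)[rule_format, OF \<open>z \<in> S\<close>] \<open>\<delta> > 0\<close> by simp
qed

text \<open>
  Weak maximum principle: a positive value of \<open>u\<close> would give \<open>u + \<delta> * (cmod z)\<^sup>2\<close>, whose Laplacian is
  positive, a local maximum for small \<open>\<delta>\<close>.
\<close>

lemma harmonic_on_nonpos:
  assumes u: "harmonic_on u S"
    and frontier: "\<And>w. w \<in> frontier S \<Longrightarrow> (u \<longlongrightarrow> 0) (at w within S)"
    and infinity: "eventually (\<lambda>z. u z < 0) at_infinity"
    and "z \<in> S"
  shows "u z \<le> 0"
proof (rule ccontr)
  define M where "M = u z"
  assume "\<not> u z \<le> 0"
  then have M: "M > 0"
    by (simp add: M_def)
  have "open S"
    using u by (simp add: harmonic_on_def)
  have cont: "continuous_on S u"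
    by (rule harmonic_on_imp_continuous_on[OF u])
  from infinity obtain R0 where R0: "\<And>z. cmod z \<ge> R0 \<Longrightarrow> u z < 0"
    unfolding eventually_at_infinity by blast
  define R where "R = max R0 1"
  have R: "R > 0" "\<And>z. cmod z \<ge> R \<Longrightarrow> u z < 0"
    using R0 by (auto simp: R_def)
  \<comment> \<open>With this choice the added square is at most \<open>M / 4\<close> for
    \<open>cmod w \<le> R\<close>, too little to move a maximum out of the region where
    \<open>u\<close> exceeds \<open>M / 2\<close>.\<close>
  define \<delta> where "\<delta> = M / (4 * R\<^sup>2)"
  have \<delta>: "\<delta> > 0" "\<delta> * R\<^sup>2 = M / 4"
    using M R by (auto simp: \<delta>_def)
  \<comment> \<open>The superlevel set is compact although \<open>S\<close> is neither closed nor
    bounded: \<open>u\<close> is negative far out and tends to 0 at the frontier, so no point of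
    \<open>K\<close> is near either.\<close>
  define K where "K = {w \<in> S. M / 2 \<le> u w}"
  have small: "cmod w < R" if "w \<in> K" for w
    using that R(2)[of w] M by (force simp: K_def not_le[symmetric])
  have "closed K"
    unfolding closed_limpt
  proof (intro allI impI)
    fix w assume w: "w islimpt K"
    show "w \<in> K"
    proof (cases "w \<in> S")
      case True
      then have "isCont u w"
        using cont \<open>open S\<close> continuous_on_eq_continuous_at by blast
      moreover have "frequently (\<lambda>x. M / 2 \<le> u x) (at w)"
        using w unfolding islimpt_conv_frequently_at by (rule frequently_elim1) (simp add: K_def)
      ultimately have "M / 2 \<le> u w"
        using order_tendstoD(2)[of u "u w" "at w" "M / 2"]
        unfolding isCont_def frequently_def by (force simp: not_le)
      with True show ?thesis
        by (simp add: K_def)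
    next
      case False
      have "w islimpt S"
        using w by (rule islimpt_subset) (auto simp: K_def)
      then have "w \<in> frontier S"
        using False \<open>open S\<close> by (simp add: frontier_def closure_def interior_open)
      then have "eventually (\<lambda>x. u x < M / 2) (at w within S)"
        using order_tendstoD(2)[OF frontier, of w "M / 2"] M by simp
      then have "eventually (\<lambda>x. x \<notin> K) (at w)"
        unfolding eventually_at_filter by eventually_elim (auto simp: K_def)
      then show ?thesis
        using w unfolding islimpt_conv_frequently_at frequently_def by simp
    qed
  qed
  moreover have "bounded K"
    using small unfolding bounded_iff by (meson less_imp_le)
  ultimately have "compact K"
    by (simp add: compact_eq_bounded_closed)
  have "z \<in> K"
    using \<open>z \<in> S\<close> M by (simp add: K_def M_def)
  define v where "v w = u w + \<delta> * (cmod w)\<^sup>2" for w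
  have "continuous_on K v"
    unfolding v_def by (intro continuous_intros continuous_on_subset[OF cont]) (auto simp: K_def)
  with continuous_attains_sup[OF \<open>compact K\<close>] \<open>z \<in> K\<close> obtain y
    where y: "y \<in> K" "\<And>w. w \<in> K \<Longrightarrow> v w \<le> v y"
    by blast
  have "\<delta> * (cmod y)\<^sup>2 \<le> M / 4"
    using small[OF y(1)] \<delta> R(1) by (metis less_imp_le mult_left_mono norm_ge_zero power_mono)
  moreover have "M \<le> v y"
    using y(2)[OF \<open>z \<in> K\<close>] \<delta>(1) by (simp add: v_def M_def) (smt (verit) mult_nonneg_nonneg zero_le_power2)
  \<comment> \<open>The value of \<open>u\<close> at \<open>y\<close> is at least
    \<open>M - M / 4\<close>. The strict inequality puts a neighbourhood of \<open>y\<close> inside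
    \<open>K\<close>, so the maximum over \<open>K\<close> is a local maximum in the plane.\<close>
  ultimately have "u y > M / 2"
    using M by (simp add: v_def)
  moreover have "y \<in> S"
    using y(1) by (simp add: K_def)
  moreover from this have "isCont u y"
    using cont \<open>open S\<close> continuous_on_eq_continuous_at by blast
  ultimately have "eventually (\<lambda>w. M / 2 < u w) (nhds y)"
    using order_tendstoD(1)[of u "u y" "nhds y" "M / 2"] by (simp add: isCont_def tendsto_at_iff_tendsto_nhds)
  then have "eventually (\<lambda>w. u w + \<delta> * (cmod w)\<^sup>2 \<le> u y + \<delta> * (cmod y)\<^sup>2) (nhds y)"
    using eventually_nhds_in_open[OF \<open>open S\<close> \<open>y \<in> S\<close>]
  proof eventually_elim
    case (elim w)
    then show ?case
      using y(2)[of w] by (simp add: K_def v_def)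
  qed
  with harmonic_add_square_no_local_max[OF u \<open>y \<in> S\<close> \<delta>(1)] show False .
qed

text \<open>
  The difference of the two functions is bounded at infinity, so the maximum principle applies only after
  subtracting \<open>\<epsilon> * G\<close>, which tends to infinity.
\<close>

lemma Green_function_mono:
  assumes G: "is_Green_function e G" and H: "is_Green_function e H"
  shows "G z \<le> H z"
proof (cases "z \<in> outside e")
  case False
  then show ?thesis
    using assms by (simp add: is_Green_function_def)
next
  case True
  have bound: "\<exists>C. eventually (\<lambda>z. \<bar>G z - ln (cmod z)\<bar> \<le> C) at_infinity"
    if "is_Green_function e G" for G
    using that unfolding is_Green_function_def by (auto elim!: landau_o.bigE)
  from bound[OF G] obtain C where C: "eventually (\<lambda>z. \<bar>G z - ln (cmod z)\<bar> \<le> C) at_infinity"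
    by blast
  from bound[OF H] obtain D where D: "eventually (\<lambda>z. \<bar>H z - ln (cmod z)\<bar> \<le> D) at_infinity"
    by blast
  have "(1 - \<epsilon>) * G z + (- 1) * H z \<le> 0" if "\<epsilon> > 0" for \<epsilon>
  proof (rule harmonic_on_nonpos[OF harmonic_on_linear_combination _ _ True])
    show "harmonic_on G (outside e)" "harmonic_on H (outside e)"
      using assms by (simp_all add: is_Green_function_def)
    show "((\<lambda>z. (1 - \<epsilon>) * G z + - 1 * H z) \<longlongrightarrow> 0) (at w within outside e)"
      if "w \<in> frontier (outside e)" for w
      using assms that unfolding is_Green_function_def by (auto intro!: tendsto_eq_intros)
    \<comment> \<open>Beyond this threshold \<open>G z\<close> exceeds
      \<open>(C + D) / \<epsilon>\<close>, whereas \<open>G z - H z\<close> never exceeds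
      \<open>C + D\<close> there.\<close>
    have "eventually (\<lambda>z::complex. (C + D) / \<epsilon> + C < ln (cmod z)) at_infinity"
      using filterlim_compose[OF ln_at_top filterlim_norm_at_top]
      unfolding filterlim_at_top_dense by blast
    with C D show "eventually (\<lambda>z. (1 - \<epsilon>) * G z + - 1 * H z < 0) at_infinity"
    proof eventually_elim
      case (elim z)
      then have "(C + D) / \<epsilon> < G z"
        by linarith
      then have "C + D < \<epsilon> * G z"
        using \<open>\<epsilon> > 0\<close> by (simp add: field_simps)
      with elim have "G z - H z < \<epsilon> * G z"
        by linarith
      then show ?case
        by (simp add: algebra_simps)
    qed
  qed
  then have le: "G z - H z \<le> \<epsilon> * G z" if "\<epsilon> > 0" for \<epsilon>
    using that by (simp add: algebra_simps)
  have "((\<lambda>\<epsilon>. \<epsilon> * G z) \<longlongrightarrow> 0 * G z) (at_right 0)"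
    by (intro tendsto_intros)
  moreover have "eventually (\<lambda>\<epsilon>. G z - H z \<le> \<epsilon> * G z) (at_right 0)"
    using le by (auto intro: eventually_mono[OF eventually_at_right_less])
  ultimately have "G z - H z \<le> 0 * G z"
    by (rule tendsto_lowerbound) simp
  then show ?thesis
    by simp
qed

lemma Green_function_eqI:
  assumes "is_Green_function e G"
  shows "Green_function e = G"
  unfolding Green_function_def
proof (rule the_equality)
  show "H = G" if "is_Green_function e H" for H
    using assms that by (intro ext antisym Green_function_mono)
qed (rule assms)

section \<open>The Green function of a period set\<close>

lemma outside_eq_Compl_subset_Reals:
  fixes e :: "complex set"
  assumes "e \<subseteq> \<real>"
  shows "outside e = - e"
proof -
  have "\<not> bounded (connected_component_set (- e) z)" if "z \<notin> e" for z
  proof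
    assume "bounded (connected_component_set (- e) z)"
    then obtain B where B: "\<And>w. w \<in> connected_component_set (- e) z \<Longrightarrow> cmod w \<le> B"
      unfolding bounded_iff by blast
    \<comment> \<open>The vertical ray points away from the real axis, so after its starting point
      it never meets the axis and hence avoids \<open>e\<close>.\<close>
    define s where "s = (if Im z \<ge> 0 then \<i> else - \<i>)"
    define ray where "ray = (\<lambda>t. z + of_real t * s) ` {0..}"
    have "connected ray"
      unfolding ray_def by (intro connected_continuous_image continuous_intros) simp
    moreover have "ray \<subseteq> - e"
    proof
      fix w assume "w \<in> ray"
      then obtain t where t: "t \<ge> 0" "w = z + of_real t * s"
        by (auto simp: ray_def)
      show "w \<in> - e"
      proof (cases "t = 0")
        case False
        with t have "Im w \<noteq> 0"
          by (auto simp: s_def)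
        then show ?thesis
          using assms by (auto simp: complex_is_Real_iff)
      qed (use t that in simp)
    qed
    moreover have "z \<in> ray"
      unfolding ray_def by (rule image_eqI[of _ _ 0]) simp_all
    ultimately have "ray \<subseteq> connected_component_set (- e) z"
      by (intro connected_component_maximal)
    moreover have "z + of_real (\<bar>B\<bar> + cmod z + 1) * s \<in> ray"
      unfolding ray_def by (rule imageI) simp
    ultimately have "cmod (z + of_real (\<bar>B\<bar> + cmod z + 1) * s) \<le> B"
      using B by blast
    moreover have "cmod (of_real (\<bar>B\<bar> + cmod z + 1) * s) = \<bar>B\<bar> + cmod z + 1"
      unfolding norm_mult norm_of_real by (simp add: s_def)
    ultimately show False
      using norm_triangle_ineq4[of "z + of_real (\<bar>B\<bar> + cmod z + 1) * s" z] by simp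
  qed
  then show ?thesis
    by (auto simp: outside_def)
qed

section \<open>The Joukowski map and its height function\<close>

lemma Joukowski_cmod:
  fixes w :: complex
  assumes "w \<noteq> 0"
  shows "cmod (w + 1 / w - 2) + cmod (w + 1 / w + 2) = 2 * (cmod w + 1 / cmod w)"
proof -
  \<comment> \<open>The two focal distances become squares, and the parallelogram law makes their
    sum depend on \<open>cmod w\<close> only.\<close>
  have "w + 1 / w - 2 = (w - 1)\<^sup>2 / w" "w + 1 / w + 2 = (w + 1)\<^sup>2 / w"
    using assms by (simp_all add: field_simps power2_eq_square)
  then have "cmod (w + 1 / w - 2) + cmod (w + 1 / w + 2)
      = ((cmod (w - 1))\<^sup>2 + (cmod (w + 1))\<^sup>2) / cmod w"
    by (simp add: norm_divide norm_power add_divide_distrib)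
  also have "(cmod (w - 1))\<^sup>2 + (cmod (w + 1))\<^sup>2 = 2 * ((cmod w)\<^sup>2 + 1)"
    unfolding cmod_power2 by (simp add: power2_eq_square algebra_simps)
  also have "\<dots> / cmod w = 2 * (cmod w + 1 / cmod w)"
    using assms by (simp add: field_simps power2_eq_square)
  finally show ?thesis .
qed

lemma cosh_ln_cmod: "w \<noteq> 0 \<Longrightarrow> cosh (ln (cmod w)) = (cmod w + 1 / cmod w) / 2"
  by (simp add: cosh_ln_real inverse_eq_divide)

text \<open>
  The level sets of \<open>Joukowski_height\<close> are the ellipses with foci \<open>-2\<close> and \<open>2\<close>, the images of the
  circles \<open>cmod w = exp s\<close> under \<open>w + 1 / w\<close>; it is the Green's function of the interval \<open>{-2..2}\<close>.
\<close>

definition Joukowski_height :: "complex \<Rightarrow> real" where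
  "Joukowski_height p = arcosh ((cmod (p - 2) + cmod (p + 2)) / 4)"

lemma Joukowski_height_arg_ge_1: "(cmod (p - 2) + cmod (p + 2)) / 4 \<ge> 1"
  using norm_triangle_ineq4[of "p + 2" "p - 2"] by simp

lemma Joukowski_height_eq: "cmod w \<ge> 1 \<Longrightarrow> Joukowski_height (w + 1 / w) = ln (cmod w)"
proof -
  assume w: "cmod w \<ge> 1"
  then have "w \<noteq> 0"
    by auto
  then have "(cmod (w + 1 / w - 2) + cmod (w + 1 / w + 2)) / 4 = cosh (ln (cmod w))"
    using Joukowski_cmod[of w] cosh_ln_cmod[of w] by simp
  with w show ?thesis
    by (simp only: Joukowski_height_def) (simp add: arcosh_cosh_real)
qed

lemma continuous_on_Joukowski_height: "continuous_on A Joukowski_height"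
  unfolding Joukowski_height_def
proof (rule continuous_on_compose2[OF continuous_on_arcosh[OF order.refl]])
  show "(\<lambda>p. (cmod (p - 2) + cmod (p + 2)) / 4) ` A \<subseteq> {1..}"
    using Joukowski_height_arg_ge_1 by blast
qed (intro continuous_intros, simp)

text \<open>The two roots of \<open>w^2 - p * w + 1\<close> have product 1, so one of them has
  modulus at least 1.\<close>

lemma Joukowski_surj:
  obtains w where "cmod w \<ge> 1" "p = w + 1 / w"
proof -
  define v where "v = (p + csqrt (p\<^sup>2 - 4)) / 2"
  have v: "v * (p - v) = 1"
    using power2_csqrt[of "p\<^sup>2 - 4"] by (simp add: v_def field_simps power2_eq_square)
  then have "v \<noteq> 0"
    by auto
  then have p: "p = v + 1 / v"
    using v by (simp add: field_simps)
  show thesis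
  proof (cases "cmod v \<ge> 1")
    case True
    then show ?thesis using p that by blast
  next
    case False
    then show ?thesis
      using p that[of "1 / v"] \<open>v \<noteq> 0\<close> by (simp add: norm_divide add.commute)
  qed
qed

lemma Joukowski_height_eq_0_iff:
  "Joukowski_height p = 0 \<longleftrightarrow> p \<in> complex_of_real ` {-2..2}"
proof -
  obtain w where w: "cmod w \<ge> 1" "p = w + 1 / w"
    by (rule Joukowski_surj)
  show ?thesis
  proof
    assume "Joukowski_height p = 0"
    then have "ln (cmod w) = 0"
      using w Joukowski_height_eq[OF w(1)] by simp
    then have "cmod w = 1"
      using w(1) by (subst (asm) ln_eq_zero_iff) auto
    \<comment> \<open>On the unit circle the inverse is the conjugate, so \<open>p\<close> is twice
      the real part of \<open>w\<close>.\<close>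
    then have "w * cnj w = 1"
      by (simp add: complex_norm_square[symmetric])
    then have "p = w + cnj w"
      using w(2) by (metis nonzero_eq_divide_eq mult.commute mult_zero_left zero_neq_one)
    then have "p = of_real (2 * Re w)"
      by (simp add: complex_add_cnj)
    moreover have "\<bar>Re w\<bar> \<le> 1"
      using abs_Re_le_cmod[of w] \<open>cmod w = 1\<close> by simp
    ultimately show "p \<in> complex_of_real ` {-2..2}"
      by (intro image_eqI[of _ _ "2 * Re w"]) auto
  next
    assume "p \<in> complex_of_real ` {-2..2}"
    then obtain x where x: "-2 \<le> x" "x \<le> 2" "p = of_real x"
      by auto
    then have "p - 2 = of_real (x - 2)" "p + 2 = of_real (x + 2)"
      by simp_all
    then have "cmod (p - 2) + cmod (p + 2) = \<bar>x - 2\<bar> + \<bar>x + 2\<bar>"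
      by (simp only: norm_of_real)
    with x show "Joukowski_height p = 0"
      by (simp add: Joukowski_height_def)
  qed
qed

text \<open>Locally the function is the real part of \<open>Ln\<close> of \<open>w\<close> or of
  \<open>- w\<close>; the sign does not affect the modulus and is chosen to keep the value at
  \<open>z\<close> off the branch cut.\<close>

lemma has_derivative_ln_cmod:
  assumes w: "(w has_field_derivative w') (at z)" and nz: "w z \<noteq> 0"
  shows "((\<lambda>z. ln (cmod (w z))) has_derivative (\<lambda>h. Re (w' / w z * h))) (at z)"
proof -
  define s :: complex where "s = (if w z \<in> \<real>\<^sub>\<le>\<^sub>0 then - 1 else 1)"
  have s: "s * w z \<notin> \<real>\<^sub>\<le>\<^sub>0" "s \<noteq> 0" "cmod s = 1"
    using nz by (auto simp: s_def complex_nonpos_Reals_iff complex_eq_iff)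
  have "((\<lambda>z. Ln (s * w z)) has_field_derivative (1 / (s * w z)) * (s * w')) (at z)"
    using has_field_derivative_Ln[OF s(1)] DERIV_cmult[OF w, of s]
    unfolding inverse_eq_divide by (rule DERIV_chain2[where f = Ln and g = "\<lambda>z. s * w z"])
  then have "((\<lambda>z. Re (Ln (s * w z))) has_derivative (\<lambda>h. Re (w' / w z * h))) (at z)"
    using s(2) by (auto simp: has_field_derivative_def dest: has_derivative_Re)
  moreover have "eventually (\<lambda>z. Re (Ln (s * w z)) = ln (cmod (w z))) (nhds z)"
  proof -
    have "eventually (\<lambda>z. w z \<noteq> 0) (at z)"
      using DERIV_isCont[OF w] nz unfolding isCont_def by (rule tendsto_imp_eventually_ne)
    with nz have "eventually (\<lambda>z. w z \<noteq> 0) (nhds z)"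
      by (simp add: eventually_nhds_conv_at)
    then show ?thesis
      by eventually_elim (use s in \<open>simp add: norm_mult\<close>)
  qed
  then have "eventually (\<lambda>z. Re (Ln (s * w z)) = ln (cmod (w z))) (at z)"
    "Re (Ln (s * w z)) = ln (cmod (w z))"
    by (simp_all add: eventually_nhds_conv_at)
  ultimately show ?thesis
    by (rule has_derivative_transform_eventually) simp
qed

text \<open>
  Writing the square root of \<open>p\<^sup>2 - 4\<close> as \<open>p * csqrt (1 - 4 / p\<^sup>2)\<close> moves the branch cut to the
  interval \<open>{-2..2}\<close>.
\<close>

definition Joukowski_sqrt :: "complex \<Rightarrow> complex" where
  "Joukowski_sqrt p = p * csqrt (1 - 4 / p\<^sup>2)"

lemma Joukowski_sqrt:
  assumes p: "p \<notin> complex_of_real ` {-2..2}"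
  shows "1 - 4 / p\<^sup>2 \<notin> \<real>\<^sub>\<le>\<^sub>0" "(Joukowski_sqrt p)\<^sup>2 = p\<^sup>2 - 4" "Joukowski_sqrt p \<noteq> 0"
    and "p = (p + Joukowski_sqrt p) / 2 + 1 / ((p + Joukowski_sqrt p) / 2)"
    and "cmod ((p + Joukowski_sqrt p) / 2) \<ge> 1"
proof -
  have p0: "p \<noteq> 0"
    using p by (auto simp: image_iff dest: spec[of _ 0])
  show *: "1 - 4 / p\<^sup>2 \<notin> \<real>\<^sub>\<le>\<^sub>0"
  proof
    assume "1 - 4 / p\<^sup>2 \<in> \<real>\<^sub>\<le>\<^sub>0"
    then obtain x where x: "x \<le> 0" "1 - 4 / p\<^sup>2 = of_real x"
      by (auto simp: nonpos_Reals_def)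
    \<comment> \<open>A value on the cut forces the square of \<open>p\<close> to be
      \<open>4 / (1 - x)\<close> with \<open>x \<le> 0\<close>, hence \<open>p\<close> is
      \<open>y\<close> or \<open>- y\<close> with \<open>y\<close> between 0 and 2.\<close>
    define y where "y = sqrt (4 / (1 - x))"
    have "4 = p\<^sup>2 * (1 - of_real x)"
      using x(2) p0 by (simp add: field_simps)
    moreover have "(1 - of_real x :: complex) \<noteq> 0"
      using x(1) by (auto simp: complex_eq_iff)
    ultimately have "p\<^sup>2 = 4 / (1 - of_real x)"
      by (simp add: field_simps)
    also have "\<dots> = of_real (4 / (1 - x))"
      by simp
    also have "4 / (1 - x) = y\<^sup>2"
      using x(1) by (simp add: y_def)
    finally have "p\<^sup>2 = (of_real y)\<^sup>2"
      by simp
    then have "p = of_real y \<or> p = of_real (- y)"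
      by (simp add: power2_eq_iff)
    moreover have "y \<le> sqrt 4"
      unfolding y_def by (rule real_sqrt_le_mono) (use x(1) in \<open>simp add: field_simps\<close>)
    moreover have "0 \<le> y"
      using x(1) by (simp add: y_def)
    ultimately show False
      using p by (auto simp del: of_real_minus)
  qed
  show sq: "(Joukowski_sqrt p)\<^sup>2 = p\<^sup>2 - 4"
    using p0 by (simp add: Joukowski_sqrt_def power_mult_distrib right_diff_distrib)
  show "Joukowski_sqrt p \<noteq> 0"
    using p0 * by (auto simp: Joukowski_sqrt_def)
  define v where "v = (p + Joukowski_sqrt p) / 2"
  have v: "v * (p - v) = 1"
    using sq by (simp add: v_def field_simps power2_eq_square)
  then have "v \<noteq> 0"
    by auto
  then have inv: "p = v + 1 / v"
    using v by (simp add: field_simps)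
  then show "p = (p + Joukowski_sqrt p) / 2 + 1 / ((p + Joukowski_sqrt p) / 2)"
    by (simp only: v_def)
  \<comment> \<open>The principal root has nonnegative real part, so it is no farther from 1 than
    from -1. After multiplication by \<open>p / 2\<close> this compares \<open>1 / v\<close> with
    \<open>v\<close>.\<close>
  have "cmod (1 - csqrt (1 - 4 / p\<^sup>2)) \<le> cmod (1 + csqrt (1 - 4 / p\<^sup>2))"
    using Re_csqrt[of "1 - 4 / p\<^sup>2"] by (simp add: cmod_def power2_eq_square algebra_simps)
  then have "cmod (p * (1 - csqrt (1 - 4 / p\<^sup>2)) / 2) \<le> cmod (p * (1 + csqrt (1 - 4 / p\<^sup>2)) / 2)"
    by (simp add: norm_mult norm_divide mult_left_mono)
  moreover have "p * (1 - csqrt (1 - 4 / p\<^sup>2)) / 2 = p - v" "p * (1 + csqrt (1 - 4 / p\<^sup>2)) / 2 = v"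
    by (simp_all add: v_def Joukowski_sqrt_def field_simps)
  ultimately have "cmod (1 / v) \<le> cmod v"
    using inv by (metis add_diff_cancel_left')
  then have "1 \<le> cmod v * cmod v"
    using \<open>v \<noteq> 0\<close> by (simp add: norm_divide field_simps)
  then have "1 \<le> cmod v"
    by (intro power2_le_imp_le[of 1]) (simp_all add: power2_eq_square)
  then show "cmod ((p + Joukowski_sqrt p) / 2) \<ge> 1"
    by (simp only: v_def)
qed

text \<open>For \<open>w = (p + s) / 2\<close> with \<open>s = Joukowski_sqrt p\<close> one has
  \<open>s' = p / s\<close>, so \<open>w' = w / s\<close>, and the logarithmic derivative of
  \<open>w\<close> is \<open>1 / s\<close>.\<close>

lemma Joukowski_height_has_derivative:
  assumes p: "p \<notin> complex_of_real ` {-2..2}"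
  shows "(Joukowski_height has_derivative (\<lambda>h. Re (1 / Joukowski_sqrt p * h))) (at p)"
proof -
  define S where "S = - complex_of_real ` {-2..2}"
  define w where "w q = (q + Joukowski_sqrt q) / 2" for q
  have "open S"
    unfolding S_def by (intro open_Compl compact_imp_closed compact_continuous_image continuous_intros) simp
  have p0: "p \<noteq> 0"
    using p by (auto simp: image_iff dest: spec[of _ 0])
  have s: "(Joukowski_sqrt has_field_derivative p / Joukowski_sqrt p) (at p)"
  proof -
    define c where "c = csqrt (1 - 4 / p\<^sup>2)"
    have c: "c \<noteq> 0" "c\<^sup>2 = 1 - 4 / p\<^sup>2"
      using Joukowski_sqrt(1)[OF p] by (auto simp: c_def)
    have "((\<lambda>p. 1 - 4 / p\<^sup>2) has_field_derivative 8 / p ^ 3) (at p)"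
      using p0 by (auto intro!: derivative_eq_intros simp: field_simps eval_nat_numeral)
    from DERIV_chain2[OF has_field_derivative_csqrt[OF Joukowski_sqrt(1)[OF p]] this]
    have "(Joukowski_sqrt has_field_derivative c + (inverse (2 * c) * (8 / p ^ 3)) * p) (at p)"
      unfolding Joukowski_sqrt_def[abs_def] c_def
      using DERIV_mult[OF DERIV_ident] by fastforce
    moreover have "c + (inverse (2 * c) * (8 / p ^ 3)) * p = (c\<^sup>2 + 4 / p\<^sup>2) / c"
      using c(1) p0 by (simp add: field_simps eval_nat_numeral)
    moreover have "\<dots> = p / Joukowski_sqrt p"
      using p0 c by (simp add: Joukowski_sqrt_def c_def[symmetric])
    ultimately show ?thesis
      by simp
  qed
  have w: "(w has_field_derivative (1 + p / Joukowski_sqrt p) / 2) (at p)"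
    unfolding w_def by (intro DERIV_cdivide DERIV_add DERIV_ident s)
  have wp: "w p \<noteq> 0"
    using Joukowski_sqrt(5)[OF p] by (auto simp: w_def)
  have "(1 + p / Joukowski_sqrt p) / 2 = w p / Joukowski_sqrt p"
    using Joukowski_sqrt(3)[OF p] by (simp add: w_def field_simps)
  then have "(1 + p / Joukowski_sqrt p) / 2 / w p = 1 / Joukowski_sqrt p"
    using wp by simp
  then have "((\<lambda>q. ln (cmod (w q))) has_derivative (\<lambda>h. Re (1 / Joukowski_sqrt p * h))) (at p)"
    using has_derivative_ln_cmod[OF w wp] by (simp only:)
  then show ?thesis
  proof (rule has_derivative_transform_within_open[OF _ \<open>open S\<close>])
    show "p \<in> S"
      using p by (simp add: S_def)
    show "ln (cmod (w q)) = Joukowski_height q" if "q \<in> S" for q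
    proof -
      have q: "q \<notin> complex_of_real ` {-2..2}"
        using that by (simp add: S_def)
      have "Joukowski_height (w q + 1 / w q) = ln (cmod (w q))"
        unfolding w_def by (rule Joukowski_height_eq[OF Joukowski_sqrt(5)[OF q]])
      moreover have "w q + 1 / w q = q"
        unfolding w_def by (rule Joukowski_sqrt(4)[OF q, symmetric])
      ultimately show ?thesis
        by simp
    qed
  qed
qed

section \<open>Behaviour at infinity and the formula for the Green function\<close>

lemma Joukowski_height_asymptotics:
  assumes "cmod p \<ge> 2"
  shows "\<bar>Joukowski_height p - ln (cmod p)\<bar> \<le> ln 2"
proof -
  obtain w where w: "cmod w \<ge> 1" "p = w + 1 / w"
    by (rule Joukowski_surj)
  have inv: "cmod (1 / w) \<le> 1"
    using w(1) by (simp add: norm_divide divide_le_eq_1)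
  have "cmod p \<le> cmod w + 1"
    unfolding w(2) using norm_triangle_ineq[of w "1 / w"] inv by linarith
  then have "cmod p \<le> 2 * cmod w"
    using w(1) by simp
  moreover have "cmod w \<le> cmod p + 1"
    using norm_triangle_ineq4[of p "1 / w"] inv w(2) by simp
  then have "cmod w \<le> 2 * cmod p"
    using assms by simp
  \<comment> \<open>The moduli of \<open>p\<close> and \<open>w\<close> differ by at most 1, so each
    is at most twice the other.\<close>
  ultimately have "ln (cmod p) \<le> ln (2 * cmod w)" "ln (cmod w) \<le> ln (2 * cmod p)"
    using assms w(1) by (subst ln_le_cancel_iff; linarith)+
  moreover have "ln (2 * cmod w) = ln 2 + ln (cmod w)" "ln (2 * cmod p) = ln 2 + ln (cmod p)"
    using assms w(1) by (subst ln_mult_pos; linarith)+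
  ultimately show ?thesis
    using Joukowski_height_eq[OF w(1)] w(2) by simp
qed

lemma eventually_norm_poly_ge:
  fixes p :: "'a :: real_normed_field poly"
  assumes "degree p > 0"
  shows "eventually (\<lambda>z. c \<le> norm (poly p z)) at_infinity"
proof -
  have "filterlim (\<lambda>z. norm (poly p z)) at_top at_infinity"
    by (rule filterlim_at_infinity_imp_norm_at_top[OF filterlim_poly_at_infinity[OF assms]])
  then show ?thesis
    by (simp add: filterlim_at_top)
qed

text \<open>The height grows like \<open>ln (cmod (poly P z))\<close>, that is, like
  \<open>n * ln (cmod z)\<close>; division by \<open>n\<close> normalizes the pole. By
  \<open>Green_function_eqI\<close> only the defining properties have to be verified.\<close>

lemma Green_function_period_set:
  assumes P: "degree P = n" "n \<ge> 1"
    and e: "e \<subseteq> \<real>" "e = {z. poly P z \<in> complex_of_real ` {-2..2}}"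
  shows "Green_function e = (\<lambda>z. Joukowski_height (poly P z) / n)"
proof (rule Green_function_eqI)
  define G where "G = (\<lambda>z. Joukowski_height (poly P z) / n)"
  have out: "outside e = - e"
    by (rule outside_eq_Compl_subset_Reals[OF e(1)])
  have "closed (complex_of_real ` {-2..2})"
    by (intro compact_imp_closed compact_continuous_image continuous_intros) simp
  then have "closed e"
    unfolding e(2) using continuous_closed_vimage[of _ "poly P"] by (simp add: vimage_def)
  then have "open (- e)"
    by (rule open_Compl)
  have contG: "isCont G z" for z
    using P(2) continuous_on_Joukowski_height[of UNIV] unfolding G_def
    by (intro continuous_intros isCont_o2[OF poly_isCont])
      (auto simp: continuous_on_eq_continuous_at)
  have G0: "G z = 0" if "z \<in> e" for z
    using that by (simp add: G_def e(2) Joukowski_height_eq_0_iff)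
  have "harmonic_on G (- e)"
  proof (rule harmonic_on_real_derivative[OF \<open>open (- e)\<close>])
    let ?f = "\<lambda>z. poly (pderiv P) z / (n * Joukowski_sqrt (poly P z))"
    have nonneg: "1 - 4 / (poly P z)\<^sup>2 \<notin> \<real>\<^sub>\<le>\<^sub>0" and nz: "Joukowski_sqrt (poly P z) \<noteq> 0" "poly P z \<noteq> 0"
      if "z \<in> - e" for z
      using Joukowski_sqrt(1,3)[of "poly P z"] that by (auto simp: e(2) Joukowski_sqrt_def)
    show "?f holomorphic_on - e"
      using nonneg nz P(2) unfolding Joukowski_sqrt_def
      by (intro holomorphic_intros) auto
    fix z assume "z \<in> - e"
    then have "poly P z \<notin> complex_of_real ` {-2..2}"
      by (simp add: e(2))
    note Joukowski_height_has_derivative[OF this]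
    moreover have "(poly P has_derivative (\<lambda>h. poly (pderiv P) z * h)) (at z)"
      using poly_DERIV[of P z] by (simp add: has_field_derivative_def)
    ultimately have "((\<lambda>z. Joukowski_height (poly P z)) has_derivative
        (\<lambda>h. Re (1 / Joukowski_sqrt (poly P z) * (poly (pderiv P) z * h)))) (at z)"
      by (rule has_derivative_compose[rotated])
    from has_derivative_mult_right[OF this, of "1 / n"]
    have "((\<lambda>z. 1 / n * Joukowski_height (poly P z)) has_derivative
        (\<lambda>h. 1 / n * Re (1 / Joukowski_sqrt (poly P z) * (poly (pderiv P) z * h)))) (at z)" .
    moreover have "1 / n * Re x = Re (x / n)" for x :: complex
      by simp
    then have "(\<lambda>h. 1 / n * Re (1 / Joukowski_sqrt (poly P z) * (poly (pderiv P) z * h)))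
        = (\<lambda>h. Re (?f z * h))"
      by (intro ext, simp only:) (rule arg_cong[of _ _ Re], simp)
    moreover have "G = (\<lambda>z. 1 / n * Joukowski_height (poly P z))"
      by (simp add: G_def)
    ultimately show "(G has_derivative (\<lambda>h. Re (?f z * h))) (at z)"
      by (simp only:)
  qed
  moreover have "(\<lambda>z. G z - ln (cmod z)) \<in> O[at_infinity](\<lambda>_. 1)"
  proof (rule bigoI)
    define c where "c = cmod (lead_coeff P)"
    have c: "c > 0"
      using P by (auto simp: c_def)
    \<comment> \<open>The quotient tends to the leading coefficient. In the final bound
      \<open>ln 2\<close> comes from the height, and \<open>\<bar>ln c\<bar> + 1\<close> from this
      limit with error less than 1.\<close>
    have "((\<lambda>z. ln (cmod (poly P z / z ^ n))) \<longlongrightarrow> ln c) at_infinity"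
      using poly_divide_tendsto_aux[of P] c P(1) unfolding c_def
      by (intro tendsto_ln tendsto_norm) auto
    then have "eventually (\<lambda>z. dist (ln (cmod (poly P z / z ^ n))) (ln c) < 1) at_infinity"
      by (rule tendstoD) simp
    moreover have "eventually (\<lambda>z. cmod (poly P z) \<ge> 2) at_infinity"
      using P by (intro eventually_norm_poly_ge) simp
    moreover have "eventually (\<lambda>z::complex. cmod z \<ge> 1) at_infinity"
      unfolding eventually_at_infinity by blast
    ultimately show "eventually (\<lambda>z. norm (G z - ln (cmod z)) \<le> (ln 2 + \<bar>ln c\<bar> + 1) * norm (1::real)) at_infinity"
    proof eventually_elim
      case (elim z)
      have "ln (cmod (poly P z / z ^ n)) = ln (cmod (poly P z)) - n * ln (cmod z)"
      proof -
        have "poly P z \<noteq> 0" "z \<noteq> 0"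
          using elim(2,3) by auto
        then show ?thesis
          by (simp add: norm_divide norm_power ln_div ln_realpow)
      qed
      then have "\<bar>Joukowski_height (poly P z) - n * ln (cmod z)\<bar> \<le> ln 2 + \<bar>ln c\<bar> + 1"
        using Joukowski_height_asymptotics[OF elim(2)] elim(1) unfolding dist_real_def by linarith
      moreover have "G z - ln (cmod z) = (Joukowski_height (poly P z) - n * ln (cmod z)) / n"
        using P(2) by (simp add: G_def field_simps)
      moreover have "\<bar>x / real n\<bar> \<le> \<bar>x\<bar>" for x
        using P(2) by (simp add: field_simps mult_le_cancel_left1)
      ultimately show ?case
        by (metis mult.right_neutral norm_one order_trans real_norm_def)
    qed
  qed
  moreover have "(G \<longlongrightarrow> 0) (at w within outside e)" if "w \<in> frontier (outside e)" for w
  proof -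
    \<comment> \<open>The complement of \<open>e\<close> is open, so its frontier lies in
      \<open>e\<close>, where \<open>G\<close> vanishes; continuity on the whole plane then gives
      the boundary limit.\<close>
    have "w \<in> e"
      using that \<open>open (- e)\<close> by (simp add: out frontier_def interior_open)
    then show ?thesis
      using contG[of w] G0[of w] by (metis isCont_def tendsto_within_subset subset_UNIV)
  qed
  ultimately show "is_Green_function e G"
    using G0 by (simp add: is_Green_function_def out)
qed

section \<open>Chebyshev polynomials of the level sets\<close>

text \<open>The Chebyshev polynomials of the interval \<open>{-2..2}\<close>, that is, \<open>2 * T_k (x / 2)\<close>.\<close>

fun Vieta_Lucas_poly :: "nat \<Rightarrow> 'a :: comm_ring_1 poly" where
  "Vieta_Lucas_poly 0 = [:2:]"
| "Vieta_Lucas_poly (Suc 0) = [:0, 1:]"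
| "Vieta_Lucas_poly (Suc (Suc k)) = [:0, 1:] * Vieta_Lucas_poly (Suc k) - Vieta_Lucas_poly k"

lemma poly_Vieta_Lucas_poly:
  fixes w :: "'a :: field"
  assumes "w \<noteq> 0"
  shows "poly (Vieta_Lucas_poly k) (w + 1 / w) = w ^ k + 1 / w ^ k"
  using assms by (induction k rule: Vieta_Lucas_poly.induct) (simp_all add: field_simps)

text \<open>Index 0 is left out because its polynomial is the constant 2. From index 1 on,
  multiplication by the variable raises the degree above that of the subtracted term.\<close>

lemma degree_lead_coeff_Vieta_Lucas_poly:
  "degree (Vieta_Lucas_poly (Suc k) :: 'a :: idom poly) = Suc k \<and>
   coeff (Vieta_Lucas_poly (Suc k) :: 'a poly) (Suc k) = 1"
proof (induction k rule: less_induct)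
  case (less k)
  show ?case
  proof (cases k)
    case (Suc j)
    let ?p = "[:0, 1:] * Vieta_Lucas_poly (Suc j) :: 'a poly" and ?q = "Vieta_Lucas_poly j :: 'a poly"
    have IH: "degree (Vieta_Lucas_poly (Suc j) :: 'a poly) = Suc j"
      "coeff (Vieta_Lucas_poly (Suc j) :: 'a poly) (Suc j) = 1"
      using less.IH[of j] Suc by auto
    have q: "degree ?q \<le> j"
    proof (cases j)
      case (Suc i)
      then show ?thesis using less.IH[of i] \<open>k = Suc j\<close> by simp
    qed simp
    have p: "degree ?p = Suc (Suc j)"
      using IH by (subst degree_mult_eq) auto
    have "degree (?p - ?q) = Suc (Suc j)"
      using p q degree_add_eq_left[of "- ?q" ?p] by (simp del: mult_pCons_left)
    moreover have "coeff (?p - ?q) (Suc (Suc j)) = 1"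
      using IH(2) q by (simp add: coeff_eq_0)
    ultimately show ?thesis
      by (simp add: Suc del: mult_pCons_left)
  qed simp
qed

text \<open>The polynomial does not depend on \<open>s\<close>; only the norm does, through
  \<open>cosh\<close>. Admitting \<open>s = 0\<close> lets the period set itself be treated as one
  of the level sets.\<close>

lemma Chebyshev_Joukowski_level_set:
  fixes P :: "complex poly"
  assumes n: "degree P \<ge> 1" and k: "k \<ge> 1" and s: "s \<ge> 0"
  defines "E \<equiv> {z. Joukowski_height (poly P z) = s}"
  shows "Chebyshev_poly (k * degree P) E
           = smult (inverse (lead_coeff P ^ k)) (Vieta_Lucas_poly k \<circ>\<^sub>p P)"
    and "Chebyshev_norm (k * degree P) E = 2 * cosh (k * s) / cmod (lead_coeff P) ^ k"
proof -
  define F :: "complex poly" where "F = Vieta_Lucas_poly k \<circ>\<^sub>p P"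
  define M where "M = 2 * cosh (k * s)"
  obtain j where j: "k = Suc j"
    using k by (cases k) auto
  have V: "degree (Vieta_Lucas_poly k :: complex poly) = k" "lead_coeff (Vieta_Lucas_poly k :: complex poly) = 1"
    using degree_lead_coeff_Vieta_Lucas_poly[of j, where 'a = complex] by (simp_all add: j)
  have F: "degree F = k * degree P" "lead_coeff F = lead_coeff P ^ k"
    unfolding F_def using n V
    by (simp add: degree_pcompose) (subst lead_coeff_comp, use n V in simp_all)
  have "exp (k * s) = exp s ^ k"
    by (rule exp_of_nat_mult)
  then have M: "M > 0" "M = exp s ^ k + 1 / exp s ^ k"
    by (simp_all add: M_def cosh_def exp_minus inverse_eq_divide add_pos_pos)
  have "bounded E"
  proof -
    \<comment> \<open>On \<open>E\<close> the modulus of \<open>poly P z\<close> is at most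
      \<open>2 * exp s\<close> once it is at least 2; the threshold exceeds both numbers.\<close>
    have "eventually (\<lambda>z. 2 * exp (s + 1) + 2 \<le> cmod (poly P z)) at_infinity"
      using n by (intro eventually_norm_poly_ge) simp
    then obtain B where B: "\<And>z. B \<le> cmod z \<Longrightarrow> 2 * exp (s + 1) + 2 \<le> cmod (poly P z)"
      unfolding eventually_at_infinity by blast
    have "cmod z < B" if "z \<in> E" for z
    proof (rule ccontr)
      assume "\<not> cmod z < B"
      then have *: "2 * exp (s + 1) + 2 \<le> cmod (poly P z)"
        by (intro B) simp
      have "exp (s + 1) > 0"
        by simp
      with * have "cmod (poly P z) \<ge> 2"
        by linarith
      from Joukowski_height_asymptotics[OF this] that have "ln (cmod (poly P z)) \<le> s + ln 2"
        by (simp add: E_def)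
      then have "exp (ln (cmod (poly P z))) \<le> exp (s + ln 2)"
        by (simp only: exp_le_cancel_iff)
      moreover have "exp (ln (cmod (poly P z))) = cmod (poly P z)"
        using \<open>cmod (poly P z) \<ge> 2\<close> by (intro exp_ln) linarith
      ultimately have "cmod (poly P z) \<le> 2 * exp s"
        by (simp add: exp_add)
      moreover have "exp s < exp (s + 1)"
        by simp
      ultimately show False
        using * by linarith
    qed
    then show ?thesis
      unfolding bounded_iff by (meson less_imp_le)
  qed
  have E: "z \<in> E" if z: "poly F z = of_real M \<or> poly F z = - of_real M" for z
  proof -
    obtain w where w: "cmod w \<ge> 1" "poly P z = w + 1 / w"
      by (rule Joukowski_surj)
    define r where "r = exp s ^ k"
    have r: "r \<ge> 1"
      using s by (simp add: r_def)
    have "w \<noteq> 0"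
      using w(1) by auto
    have "poly F z = w ^ k + 1 / w ^ k"
      using \<open>w \<noteq> 0\<close> by (simp add: F_def poly_pcompose w(2) poly_Vieta_Lucas_poly)
    moreover have "M = r + 1 / r"
      by (simp only: r_def M(2))
    \<comment> \<open>Squaring treats both signs together. The factorization below then says that
      the square of \<open>w ^ k\<close> is that of \<open>r\<close> or of
      \<open>1 / r\<close>.\<close>
    ultimately have "(w ^ k + 1 / w ^ k)\<^sup>2 = (of_real (r + 1 / r))\<^sup>2"
      using z by (metis power2_minus)
    moreover have "(w ^ k + 1 / w ^ k)\<^sup>2 - (of_real (r + 1 / r))\<^sup>2
        = ((w ^ k)\<^sup>2 - of_real r ^ 2) * ((w ^ k)\<^sup>2 - 1 / of_real r ^ 2) / (w ^ k)\<^sup>2"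
    proof -
      have "(x + 1 / x)\<^sup>2 - (y + 1 / y)\<^sup>2 = (x\<^sup>2 - y\<^sup>2) * (x\<^sup>2 - 1 / y\<^sup>2) / x\<^sup>2"
        if "x \<noteq> 0" "y \<noteq> 0" for x y :: complex
        using that by (simp add: field_simps power2_eq_square)
      from this[of "w ^ k" "of_real r"] show ?thesis
        using r \<open>w \<noteq> 0\<close> by simp
    qed
    ultimately have "(w ^ k)\<^sup>2 = of_real r ^ 2 \<or> (w ^ k)\<^sup>2 = 1 / of_real r ^ 2"
      using \<open>w \<noteq> 0\<close> by simp
    then have "(cmod w ^ k)\<^sup>2 = r\<^sup>2 \<or> (cmod w ^ k)\<^sup>2 = (1 / r)\<^sup>2"
      using r by (auto dest!: arg_cong[of _ _ cmod] simp: norm_power norm_divide power_one_over)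
    then have "cmod w ^ k = r \<or> cmod w ^ k = 1 / r"
      using r by (simp add: power2_eq_iff_nonneg)
    moreover have "cmod w ^ k \<ge> 1"
      using w(1) by simp
    moreover have "1 / r \<le> 1"
      using r by simp
    \<comment> \<open>As \<open>cmod w ^ k \<ge> 1 \<ge> 1 / r\<close>, the second case is possible
      only for \<open>r = 1\<close>, where it coincides with the first.\<close>
    ultimately have "cmod w ^ k = exp s ^ k"
      using r unfolding r_def by (metis div_by_1 divide_divide_eq_right mult_1 order_antisym)
    then have "cmod w = exp s"
      using k by (subst (asm) power_eq_iff_eq_base) auto
    then show ?thesis
      using Joukowski_height_eq[OF w(1)] w(2) by (simp add: E_def)
  qed
  have le: "cmod (poly F z) \<le> M" if "z \<in> E" for z
  proof -
    obtain w where w: "cmod w \<ge> 1" "poly P z = w + 1 / w"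
      by (rule Joukowski_surj)
    then have "w \<noteq> 0"
      by auto
    have "ln (cmod w) = s"
      using that Joukowski_height_eq[OF w(1)] w(2) by (simp add: E_def)
    then have "cmod w = exp s"
      using \<open>w \<noteq> 0\<close> by auto
    moreover have "poly F z = w ^ k + 1 / w ^ k"
      using \<open>w \<noteq> 0\<close> by (simp add: F_def poly_pcompose w(2) poly_Vieta_Lucas_poly)
    ultimately show ?thesis
      using norm_triangle_ineq[of "w ^ k" "1 / w ^ k"] by (simp add: M(2) norm_power norm_divide)
  qed
  have "degree F > 0"
    using F(1) n k by simp
  note Chebyshev_poly_eqI[OF this \<open>bounded E\<close> M(1) E le, unfolded F(2), unfolded F(1)]
  then show "Chebyshev_poly (k * degree P) E
        = smult (inverse (lead_coeff P ^ k)) (Vieta_Lucas_poly k \<circ>\<^sub>p P)"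
      "Chebyshev_norm (k * degree P) E = 2 * cosh (k * s) / cmod (lead_coeff P) ^ k"
    by (simp_all add: F_def M_def norm_power)
qed

theorem theorem1p4:
  fixes n k :: nat and e :: "complex set" and \<alpha> :: real
  assumes "n \<ge> 1" and "period_set n e" and "\<alpha> > 0" and "k \<ge> 1"
  shows "Chebyshev_poly (k * n) {z. Green_function e z = \<alpha>} = Chebyshev_poly (k * n) e \<and>
         Chebyshev_norm (k * n) {z. Green_function e z = \<alpha>}
           = cosh (real k * real n * \<alpha>) * Chebyshev_norm (k * n) e"
proof -
  from assms(2) obtain P where e: "e \<subseteq> \<real>" "degree P = n"
      "e = {z. poly P z \<in> complex_of_real ` {-2..2}}"
    unfolding period_set_def by blast
  have "{z. Green_function e z = \<alpha>} = {z. Joukowski_height (poly P z) = n * \<alpha>}"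
    using assms(1) Green_function_period_set[OF e(2) assms(1) e(1,3)] by (auto simp: field_simps)
  moreover have "e = {z. Joukowski_height (poly P z) = 0}"
    by (simp only: Joukowski_height_eq_0_iff) (rule e(3))
  moreover have "degree P \<ge> 1" "n * \<alpha> \<ge> 0"
    using e(2) assms by simp_all
  \<comment> \<open>The level set and \<open>e\<close> are the cases \<open>s = n * \<alpha>\<close>
    and \<open>s = 0\<close> for the same \<open>P\<close>; since \<open>cosh 0 = 1\<close>, the
    norms differ by the stated factor.\<close>
  ultimately show ?thesis
    using Chebyshev_Joukowski_level_set[of P k "n * \<alpha>"] Chebyshev_Joukowski_level_set[of P k 0] assms(4)
    by (simp add: e(2) mult_ac)
qed

end
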